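(* Let $\alpha\in\mathbb{C}$ and define $f_\alpha(z)=e^\alpha-\exp(\alpha z\,\mathrm{Log}(1+1/z))$ for $z\in\mathbb{C}\setminus[-1,0]$. Let $c>1$, $r>0$ and let $C(r,c)$ denote the rectangle with corners $-c\pm ir$, $\pm ir$, considered as a closed contour with positive orientation. Then $$\varphi_\alpha(s):=\frac{1}{2\pi i}\int_{C(r,c)}f_\alpha(z)e^{sz}\,dz,\quad s\in\mathbb{C},$$ is an entire function of $s$, which is independent of $c>1$, $r>0$, and $$f_\alpha(x)=\int_0^\infty e^{-sx}\varphi_\alpha(s)\,ds,\quad x>0.$$ Moreover, $\varphi_\alpha(s)$ is bounded for $s\in[0,\infty[$ and $\varphi_\alpha(s)\to 0$ as $s\to\infty$ (along $[0,\infty[$).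
   Context: $\mathrm{Log}$ is the principal logarithm on $\mathbb{C}\setminus]-\infty,0]$; for $z\in\mathbb{C}\setminus[-1,0]$ one has $1+1/z\notin]-\infty,0]$, so $f_\alpha$ is well defined and holomorphic there. The contour $C(r,c)$ passes through $0$ along its vertical side $[-ir,ir]$; $f_\alpha(z)\to e^\alpha-1$ as $z\to0$ within $\mathbb{C}\setminus]-\infty,0]$, and $f_\alpha(0)$ is understood as $e^\alpha-1$ on that side. *)

theory Defs
  imports "HOL-Complex_Analysis.Complex_Analysis"
begin

(* Only meaningful off the cut [-1,0] and at 0, where it takes its limiting value;
   on [-1,0) the value is an artefact of totality. *)
definition f_fun :: "complex \<Rightarrow> complex \<Rightarrow> complex" where
  "f_fun \<alpha> z = (if z = 0 then exp \<alpha> - 1 else exp \<alpha> - exp (\<alpha> * z * Ln (1 + 1 / z)))"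

(* rectpath takes the lower left and upper right corners and runs counterclockwise. *)
definition C_rect :: "real \<Rightarrow> real \<Rightarrow> real \<Rightarrow> complex" where
  "C_rect r c = rectpath (Complex (- c) (- r)) (Complex 0 r)"

definition phi :: "complex \<Rightarrow> real \<Rightarrow> real \<Rightarrow> complex \<Rightarrow> complex" where
  "phi \<alpha> r c s =
     1 / (2 * of_real pi * \<i>) * contour_integral (C_rect r c) (\<lambda>z. f_fun \<alpha> z * exp (s * z))"

end

theory Submission
  imports Defs "HOL-Real_Asymp.Real_Asymp"
begin

text \<open>
  Everything rests on deforming contours around the cut \<open>[-1, 0]\<close>. The function \<open>f_fun \<alpha>\<close> is
  holomorphic off the cut, continuous at the end point \<open>0\<close> (since \<open>z Ln (1 + 1/z) \<rightarrow> 0\<close> there), and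
  tends to \<open>0\<close> at infinity (since \<open>z Ln (1 + 1/z) \<rightarrow> 1\<close> there).

  Independence of the rectangle: two rectangles with the cut strictly inside are linearly homotopic
  off the cut, and continuity at \<open>0\<close> allows the right side to be pushed onto the imaginary axis
  (\<open>contour_integral_C_rect_eq_wider\<close>). Hence every \<open>phi \<alpha> r c s\<close> is the integral over one fixed
  rectangle. That \<open>phi\<close> is entire is differentiation under the integral sign.

  Decay on the positive real axis: on the vertical side \<open>exp (s z)\<close> has modulus \<open>1\<close>, so the sides as
  they stand would call for a Riemann-Lebesgue argument. Instead the vertical side is bent at \<open>0\<close>
  into the left half plane, where the integrand is still holomorphic; on the new contour
  \<open>Re z < 0\<close> except at finitely many points, and dominated convergence gives the limit \<open>0\<close>
  (\<open>exp_C_rect_tendsto_0\<close>). Boundedness follows by continuity.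

  Laplace transform: for \<open>x > 0\<close>, put
  \<open>\<Psi> s = exp (- s x) * (1 / (2 \<pi> \<i>)) * \<integral> f z / (z - x) * exp (s z) dz\<close> over \<open>C_rect r c\<close>. Then
  \<open>\<Psi>' s = exp (- s x) * phi s\<close> because the factor \<open>z - x\<close> produced by differentiation cancels,
  and \<open>\<Psi> \<rightarrow> 0\<close>; so the Laplace integral equals \<open>- \<Psi> 0\<close>. This is \<open>f x\<close> by Cauchy's formula for
  the exterior of the contour, where \<open>f\<close> vanishes at infinity (\<open>Cauchy_exterior_C_rect\<close>).
\<close>

section \<open>The function off the cut\<close>

definition slit :: "complex set" where
  "slit = {z. Im z = 0 \<and> - 1 \<le> Re z \<and> Re z \<le> 0}"

lemma slit_eq_segment: "slit = closed_segment (- 1) 0"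
proof -
  have "closed_segment (- 1) (0::complex) = complex_of_real ` {- 1..0}"
    using closed_segment_of_real[of "- 1" 0, where 'a = complex]
    by (simp add: closed_segment_eq_real_ivl)
  also have "\<dots> = slit"
  proof (intro equalityI subsetI)
    fix z assume "z \<in> slit"
    then have "z = complex_of_real (Re z)" "Re z \<in> {- 1..0}"
      by (auto simp: slit_def complex_eq_iff)
    then show "z \<in> complex_of_real ` {- 1..0}" by blast
  qed (auto simp: slit_def)
  finally show ?thesis by simp
qed

lemma closed_slit: "closed slit"
  by (simp add: slit_eq_segment)

lemma one_plus_inverse_notin_nonpos_Reals:
  assumes "z \<notin> slit"
  shows "1 + 1 / z \<notin> \<real>\<^sub>\<le>\<^sub>0"
proof
  assume "1 + 1 / z \<in> \<real>\<^sub>\<le>\<^sub>0"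
  then obtain t where t: "1 + 1 / z = complex_of_real t" "t \<le> 0"
    by (auto elim!: nonpos_Reals_cases)
  have "z \<noteq> 0" using assms by (auto simp: slit_def)
  with t have "complex_of_real (t - 1) * z = 1"
    by (simp add: field_simps)
  then have "z = complex_of_real (1 / (t - 1))"
    using t by (simp add: field_simps)
  moreover have "- 1 \<le> 1 / (t - 1)" "1 / (t - 1) \<le> 0"
    using t by (auto simp: field_simps)
  ultimately show False
    using assms by (auto simp: slit_def)
qed

lemma f_fun_holomorphic: "f_fun \<alpha> holomorphic_on - slit"
proof -
  have "(\<lambda>z. exp \<alpha> - exp (\<alpha> * z * Ln (1 + 1 / z))) holomorphic_on - slit"
    using one_plus_inverse_notin_nonpos_Reals
    by (intro holomorphic_intros) (auto simp: slit_def)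
  then show ?thesis
    by (rule holomorphic_transform) (auto simp: f_fun_def slit_def)
qed

lemma norm_Ln_le_ln_norm:
  assumes "1 \<le> norm w"
  shows "norm (Ln w) \<le> ln (norm w) + pi"
proof -
  have "w \<noteq> 0" using assms by auto
  have "norm (Ln w) \<le> \<bar>Re (Ln w)\<bar> + \<bar>Im (Ln w)\<bar>" by (rule cmod_le)
  also have "\<bar>Re (Ln w)\<bar> = ln (norm w)" using assms \<open>w \<noteq> 0\<close> by simp
  also have "\<bar>Im (Ln w)\<bar> \<le> pi"
    using mpi_less_Im_Ln[OF \<open>w \<noteq> 0\<close>] Im_Ln_le_pi[OF \<open>w \<noteq> 0\<close>] by auto
  finally show ?thesis by simp
qed

text \<open>Near \<open>0\<close> the modulus of \<open>1 + 1/z\<close> lies between \<open>1\<close> and \<open>2 / norm z\<close>, so the logarithm grows only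
  like \<open>ln (1 / norm z)\<close> and is killed by the factor \<open>z\<close>. The bound on the imaginary part of \<open>Ln\<close>
  holds for every nonzero argument, so the limit may be taken over a full neighbourhood of \<open>0\<close>.\<close>

lemma f_fun_isCont_0: "isCont (f_fun \<alpha>) 0"
proof -
  have bound: "norm (z * Ln (1 + 1 / z)) \<le> norm z * (ln (2 / norm z) + pi)"
    if "z \<noteq> 0" "norm z < 1 / 2" for z :: complex
  proof -
    have "1 / norm z - 1 \<le> norm (1 + 1 / z)"
      using norm_diff_ineq[of "1 / z" 1] by (simp add: norm_divide add.commute)
    moreover have "2 < 1 / norm z" using that by (simp add: field_simps)
    ultimately have ge: "1 \<le> norm (1 + 1 / z)" by simp
    have "norm (1 + 1 / z) \<le> 1 + 1 / norm z"
      using norm_triangle_ineq[of 1 "1 / z"] by (simp add: norm_divide)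
    also have "\<dots> \<le> 2 / norm z" using that by (simp add: field_simps)
    finally have "ln (norm (1 + 1 / z)) \<le> ln (2 / norm z)"
      using ge by (subst ln_le_cancel_iff) auto
    with norm_Ln_le_ln_norm[OF ge] show ?thesis
      by (simp add: norm_mult mult_left_mono)
  qed
  have "((\<lambda>t::real. t * (ln (2 / t) + pi)) \<longlongrightarrow> 0) (at_right 0)" by real_asymp
  moreover have "filterlim (norm :: complex \<Rightarrow> real) (at_right 0) (at 0)"
    unfolding filterlim_at by (auto intro: tendsto_eq_intros simp: eventually_at_filter)
  ultimately have "((\<lambda>z::complex. norm z * (ln (2 / norm z) + pi)) \<longlongrightarrow> 0) (at 0)"
    by (rule filterlim_compose)
  then have lim: "((\<lambda>z. z * Ln (1 + 1 / z)) \<longlongrightarrow> 0) (at 0)"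
  proof (rule Lim_null_comparison[rotated])
    show "\<forall>\<^sub>F z in at 0. norm (z * Ln (1 + 1 / z)) \<le> norm z * (ln (2 / norm z) + pi)"
      unfolding eventually_at using bound by (intro exI[of _ "1/2"]) auto
  qed
  have "((\<lambda>z. exp \<alpha> - exp (\<alpha> * (z * Ln (1 + 1 / z)))) \<longlongrightarrow> exp \<alpha> - exp (\<alpha> * 0)) (at 0)"
    by (intro tendsto_intros lim)
  then have "((\<lambda>z. exp \<alpha> - exp (\<alpha> * (z * Ln (1 + 1 / z)))) \<longlongrightarrow> exp \<alpha> - 1) (at 0)"
    by simp
  then have "(f_fun \<alpha> \<longlongrightarrow> exp \<alpha> - 1) (at 0)"
    by (rule Lim_transform_eventually)
      (auto simp: eventually_at_filter f_fun_def mult.assoc)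
  then show ?thesis by (simp add: isCont_def f_fun_def)
qed

text \<open>With \<open>h = 1/z\<close>, the expression \<open>z Ln (1 + 1/z)\<close> is the difference quotient of \<open>Ln\<close> at \<open>1\<close>, which
  tends to \<open>1\<close>.\<close>

lemma f_fun_tendsto_0_at_infinity: "(f_fun \<alpha> \<longlongrightarrow> 0) at_infinity"
proof -
  have "(Ln has_field_derivative 1) (at 1)"
    by (auto intro!: derivative_eq_intros)
  then have "((\<lambda>h::complex. Ln (1 + h) / h) \<longlongrightarrow> 1) (at 0)"
    by (simp add: DERIV_def)
  moreover have "filterlim (inverse :: complex \<Rightarrow> complex) (at 0) at_infinity"
    by (auto simp: filterlim_at tendsto_inverse_0
        intro: eventually_mono[OF eventually_not_equal_at_infinity[of 0]])
  ultimately have lim: "((\<lambda>z::complex. Ln (1 + inverse z) / inverse z) \<longlongrightarrow> 1) at_infinity"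
    by (rule filterlim_compose)
  have "((\<lambda>z. exp \<alpha> - exp (\<alpha> * (Ln (1 + inverse z) / inverse z))) \<longlongrightarrow> exp \<alpha> - exp (\<alpha> * 1)) at_infinity"
    by (intro tendsto_intros lim)
  then have "((\<lambda>z. exp \<alpha> - exp (\<alpha> * (Ln (1 + inverse z) / inverse z))) \<longlongrightarrow> 0) at_infinity"
    by simp
  then show ?thesis
    by (rule Lim_transform_eventually)
      (use eventually_not_equal_at_infinity[of "0::complex"] in \<open>auto elim!: eventually_mono simp: f_fun_def field_simps\<close>)
qed

text \<open>The contours considered below meet the cut at most in \<open>0\<close>, so this supplies all the continuity
  needed for integrating along them.\<close>

lemma continuous_on_off_slit:
  assumes "h holomorphic_on - slit" and "isCont h 0"
    and "A \<inter> slit \<subseteq> {0}"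
  shows "continuous_on A h"
proof -
  have "isCont h z" if "z \<in> A" for z
  proof (cases "z = 0")
    case False
    then have "z \<in> - slit" using that assms(3) by auto
    then show ?thesis
      using assms(1) closed_slit
      by (metis continuous_on_eq_continuous_at holomorphic_on_imp_continuous_on open_Compl)
  qed (simp add: assms(2))
  then show ?thesis by (simp add: continuous_at_imp_continuous_on)
qed

section \<open>Rectangular contours around the cut\<close>

lemma continuous_on_rectpath_integrable:
  assumes "continuous_on (path_image (rectpath a b)) h"
  shows "h contour_integrable_on rectpath a b"
  using assms
  by (auto simp: rectpath_def Let_def path_image_join contour_integrable_join
      intro!: contour_integrable_continuous_linepath elim!: continuous_on_subset)

lemma contour_integral_rectpath:
  assumes "continuous_on (path_image (rectpath a b)) h"
  shows "contour_integral (rectpath a b) h =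
           contour_integral (linepath a (Complex (Re b) (Im a))) h
         + contour_integral (linepath (Complex (Re b) (Im a)) b) h
         + contour_integral (linepath b (Complex (Re a) (Im b))) h
         + contour_integral (linepath (Complex (Re a) (Im b)) a) h"
  using continuous_on_rectpath_integrable[OF assms]
  by (simp add: rectpath_def Let_def)

lemma path_image_rectpath_Int_slit:
  assumes "c > 1" "r > 0" "e \<ge> 0"
  shows "path_image (rectpath (Complex (- c) (- r)) (Complex e r)) \<inter> slit \<subseteq> {0}"
    and "e > 0 \<Longrightarrow> path_image (rectpath (Complex (- c) (- r)) (Complex e r)) \<inter> slit = {}"
  using assms by (auto simp: path_image_rectpath slit_def complex_eq_iff)

text \<open>Both rectangles are parametrized side by side, so at each time the two points lie on corresponding
  sides. These sides lie in a common open half plane that misses the cut; half planes are convex, so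
  the linear homotopy stays off the cut.\<close>

lemma homotopic_rectpaths_around_slit:
  assumes "c > 1" "r > 0" "e > 0" "c' > 1" "r' > 0" "e' > 0"
  shows "homotopic_loops (- slit) (rectpath (Complex (- c) (- r)) (Complex e r))
           (rectpath (Complex (- c') (- r')) (Complex e' r'))"
    (is "homotopic_loops _ ?g ?h")
proof (rule homotopic_loops_linear)
  fix t :: real assume t: "t \<in> {0..1}"
  have convex: "convex {z. Im z < 0}" "convex {z. Im z > 0}" "convex {z. Re z < - 1}" "convex {z. Re z > 0}"
    by (simp_all add: convex_halfspace_Im_lt convex_halfspace_Im_gt convex_halfspace_Re_lt convex_halfspace_Re_gt)
  have side: "closed_segment (linepath a b u) (linepath a' b' u) \<subseteq> H"
    if "convex H" "a \<in> H" "b \<in> H" "a' \<in> H" "b' \<in> H" "u \<in> {0..1}"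
    for a b a' b' :: complex and u and H
    by (rule closed_segment_subset)
      (use that in \<open>auto simp: linepath_def intro!: convexD_alt\<close>)
  (* The joined path runs through its four sides on time intervals of lengths 1/2, 1/4, 1/8, 1/8. *)
  consider "t \<le> 1/2" | "1/2 < t" "t \<le> 3/4" | "3/4 < t" "t \<le> 7/8" | "7/8 < t"
    by linarith
  then have "\<exists>H \<in> {{z. Im z < 0}, {z. Im z > 0}, {z. Re z < - 1}, {z. Re z > 0}}.
      closed_segment (?g t) (?h t) \<subseteq> H"
  proof cases
    case 1
    have "closed_segment (?g t) (?h t) \<subseteq> {z. Im z < 0}"
      using 1 t assms by (simp add: rectpath_def Let_def joinpaths_def) (intro side convex; simp)
    then show ?thesis by blast
  next
    case 2
    have "closed_segment (?g t) (?h t) \<subseteq> {z. Re z > 0}"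
      using 2 t assms by (simp add: rectpath_def Let_def joinpaths_def) (intro side convex; simp)
    then show ?thesis by blast
  next
    case 3
    have "closed_segment (?g t) (?h t) \<subseteq> {z. Im z > 0}"
      using 3 t assms by (simp add: rectpath_def Let_def joinpaths_def) (intro side convex; simp)
    then show ?thesis by blast
  next
    case 4
    have "closed_segment (?g t) (?h t) \<subseteq> {z. Re z < - 1}"
      using 4 t assms by (simp add: rectpath_def Let_def joinpaths_def) (intro side convex; simp)
    then show ?thesis by blast
  qed
  then show "closed_segment (?g t) (?h t) \<subseteq> - slit"
    by (auto simp: slit_def)
qed auto

lemma contour_integral_rectpath_around_slit:
  assumes "h holomorphic_on - slit"
    and "c > 1" "r > 0" "e > 0" "c' > 1" "r' > 0" "e' > 0"
  shows "contour_integral (rectpath (Complex (- c) (- r)) (Complex e r)) h =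
         contour_integral (rectpath (Complex (- c') (- r')) (Complex e' r')) h"
  using homotopic_rectpaths_around_slit[OF assms(2-)] assms(1) closed_slit
  by (intro Cauchy_theorem_homotopic_loops) auto

text \<open>The two contours differ by the boundary of a rectangle in the closed right half plane. That boundary
  passes through \<open>0\<close>, where the function need not be holomorphic, so Cauchy's theorem is used in the
  form for functions continuous on a convex set and holomorphic in its interior.\<close>

lemma contour_integral_C_rect_eq_wider:
  assumes holo: "h holomorphic_on - slit" and cont: "isCont h 0"
    and pos: "c > 1" "r > 0" "e > 0"
  shows "contour_integral (C_rect r c) h =
         contour_integral (rectpath (Complex (- c) (- r)) (Complex e r)) h"
proof -
  let ?I = "\<lambda>a b. contour_integral (linepath a b) h"
  note cont' = continuous_on_off_slit[OF holo cont]
  have seg: "closed_segment (Complex a y) (Complex b y) \<inter> slit = {}" if "y \<noteq> 0" for a b y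
    using that closed_segment_same_Im[of "Complex a y" "Complex b y"] by (auto simp: slit_def)
  have C: "contour_integral (C_rect r c) h =
      ?I (Complex (- c) (- r)) (Complex 0 (- r)) + ?I (Complex 0 (- r)) (Complex 0 r)
      + ?I (Complex 0 r) (Complex (- c) r) + ?I (Complex (- c) r) (Complex (- c) (- r))"
    unfolding C_rect_def
    using path_image_rectpath_Int_slit[of c r 0] pos
    by (subst contour_integral_rectpath) (auto intro!: cont')
  have W: "contour_integral (rectpath (Complex (- c) (- r)) (Complex e r)) h =
      ?I (Complex (- c) (- r)) (Complex e (- r)) + ?I (Complex e (- r)) (Complex e r)
      + ?I (Complex e r) (Complex (- c) r) + ?I (Complex (- c) r) (Complex (- c) (- r))"
    using path_image_rectpath_Int_slit[of c r e] pos
    by (subst contour_integral_rectpath) (auto intro!: cont')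
  have right: "path_image (rectpath (Complex 0 (- r)) (Complex e r)) \<subseteq> {z. Re z \<ge> 0}"
    using pos by (auto simp: path_image_rectpath)
  have cont_right: "continuous_on {z. Re z \<ge> 0} h"
    by (rule cont') (auto simp: slit_def complex_eq_iff)
  have "(h has_contour_integral 0) (rectpath (Complex 0 (- r)) (Complex e r))"
  proof (rule Cauchy_theorem_convex[OF cont_right, where K = "{}"])
    fix z assume "z \<in> interior {z. Re z \<ge> 0} - {}"
    then have "z \<in> - slit"
      using interior_halfspace_ge[of "1::complex" 0] by (auto simp: inner_complex_def slit_def)
    then show "h field_differentiable at z"
      using holo closed_slit by (metis holomorphic_on_imp_differentiable_at open_Compl)
  qed (use right in \<open>auto simp: convex_halfspace_Re_ge\<close>)
  then have R: "0 = ?I (Complex 0 (- r)) (Complex e (- r)) + ?I (Complex e (- r)) (Complex e r)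
      + ?I (Complex e r) (Complex 0 r) + ?I (Complex 0 r) (Complex 0 (- r))"
    using contour_integral_rectpath[OF continuous_on_subset[OF cont_right right]]
    by (simp add: contour_integral_unique)
  have split1: "?I (Complex (- c) (- r)) (Complex e (- r)) =
      ?I (Complex (- c) (- r)) (Complex 0 (- r)) + ?I (Complex 0 (- r)) (Complex e (- r))"
    using pos seg
    by (intro contour_integral_split_linepath cont')
       (simp, simp add: closed_segment_same_Im closed_segment_eq_real_ivl)
  have split2: "?I (Complex e r) (Complex (- c) r) =
      ?I (Complex e r) (Complex 0 r) + ?I (Complex 0 r) (Complex (- c) r)"
    using pos seg
    by (intro contour_integral_split_linepath cont')
       (simp, simp add: closed_segment_same_Im closed_segment_eq_real_ivl)
  have "?I (Complex 0 r) (Complex 0 (- r)) = - ?I (Complex 0 (- r)) (Complex 0 r)"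
    using contour_integral_reversepath[of "linepath (Complex 0 (- r)) (Complex 0 r)" h] by simp
  with R have "?I (Complex 0 (- r)) (Complex 0 r) = ?I (Complex 0 (- r)) (Complex e (- r))
      + ?I (Complex e (- r)) (Complex e r) + ?I (Complex e r) (Complex 0 r)"
    by (simp add: algebra_simps)
  with split1 split2 C W show ?thesis by simp
qed

section \<open>Cauchy's formula for the exterior of the contour\<close>

text \<open>The quotient \<open>g z = (f z - f x) / (z - x)\<close> has a removable singularity, so its integral does not
  change when \<open>C_rect r c\<close> is replaced by a large square. The winding number of the former around \<open>x\<close>
  is \<open>0\<close>, that of the latter is \<open>1\<close>; and on the large square \<open>f z / (z - x)\<close> integrates to
  something arbitrarily small because \<open>f\<close> vanishes at infinity.\<close>

lemma Cauchy_exterior_C_rect: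
  assumes holo: "f holomorphic_on - slit" and cont: "isCont f 0"
    and infinity: "(f \<longlongrightarrow> 0) at_infinity"
    and pos: "c > 1" "r > 0" and x: "Re x > 0"
  shows "contour_integral (C_rect r c) (\<lambda>z. f z / (z - x)) = - (2 * of_real pi * \<i> * f x)"
proof -
  define g where "g = (\<lambda>z. if z = x then deriv f x else (f z - f x) / (z - x))"
  note cont' = continuous_on_off_slit[OF holo cont]
  have x_C: "x \<notin> path_image (C_rect r c)"
    using x pos by (auto simp: C_rect_def path_image_rectpath)
  have C_slit: "path_image (C_rect r c) \<inter> slit \<subseteq> {0}"
    using path_image_rectpath_Int_slit(1)[of c r 0] pos by (auto simp: C_rect_def)
  have g_holo: "g holomorphic_on - slit"
    unfolding g_def using closed_slit by (intro pole_lemma_open holo) auto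
  have "\<forall>\<^sub>F z in nhds 0. g z = (f z - f x) / (z - x)"
  proof (rule eventually_mono[OF t1_space_nhds])
    show "0 \<noteq> x" using x by auto
  qed (simp add: g_def)
  then have g_cont: "isCont g 0"
    using x by (subst isCont_cong) (auto intro!: continuous_intros cont)
  have f_int: "(\<lambda>z. f z / (z - x)) contour_integrable_on rectpath a b"
    and one_int: "(\<lambda>z. f x / (z - x)) contour_integrable_on rectpath a b"
    if "path_image (rectpath a b) \<inter> slit \<subseteq> {0}" "x \<notin> path_image (rectpath a b)" for a b
    using that by (auto intro!: continuous_on_rectpath_integrable continuous_intros cont')
  have g_eq: "contour_integral (rectpath a b) g = contour_integral (rectpath a b) (\<lambda>z. f z / (z - x))
      - f x * (2 * of_real pi * \<i> * winding_number (rectpath a b) x)"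
    if *: "path_image (rectpath a b) \<inter> slit \<subseteq> {0}" "x \<notin> path_image (rectpath a b)" for a b
  proof -
    have "contour_integral (rectpath a b) g
        = contour_integral (rectpath a b) (\<lambda>z. f z / (z - x) - f x / (z - x))"
      using *(2) by (intro contour_integral_eq) (auto simp: g_def diff_divide_distrib)
    also have "\<dots> = contour_integral (rectpath a b) (\<lambda>z. f z / (z - x))
        - contour_integral (rectpath a b) (\<lambda>z. f x / (z - x))"
      using f_int[OF *] one_int[OF *] by (rule contour_integral_diff)
    also have "contour_integral (rectpath a b) (\<lambda>z. f x / (z - x))
        = f x * contour_integral (rectpath a b) (\<lambda>z. 1 / (z - x))"
    proof -
      have "(\<lambda>z. 1 / (z - x)) contour_integrable_on rectpath a b"
        using *(2) by (intro continuous_on_rectpath_integrable continuous_intros) auto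
      from contour_integral_lmul[OF this, of "f x"] show ?thesis by simp
    qed
    also have "contour_integral (rectpath a b) (\<lambda>z. 1 / (z - x)) =
        2 * of_real pi * \<i> * winding_number (rectpath a b) x"
      using *(2) by (subst winding_number_valid_path) auto
    finally show ?thesis .
  qed
  have C_eq: "contour_integral (C_rect r c) g = contour_integral (C_rect r c) (\<lambda>z. f z / (z - x))"
    unfolding C_rect_def using x pos x_C C_slit
    by (subst g_eq) (auto simp: C_rect_def winding_number_rectpath_outside in_cbox_complex_iff)
  (* I is the integral of f z / (z - x) over any large square; each of the four sides of length 2 R
     contributes at most (2 \<epsilon> / R) * (2 R) to it. *)
  define I where "I = contour_integral (C_rect r c) g + 2 * of_real pi * \<i> * f x"
  have "norm I \<le> 16 * \<epsilon>" if "\<epsilon> > 0" for \<epsilon> :: real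
  proof -
    from infinity \<open>\<epsilon> > 0\<close> obtain B where B: "\<And>z. norm z \<ge> B \<Longrightarrow> norm (f z) \<le> \<epsilon>"
      unfolding Lim_at_infinity by (metis dist_0_norm dist_commute less_imp_le)
    define R where "R = max 2 (max B (2 * norm x))"
    have R: "R \<ge> 2" "R \<ge> B" "R \<ge> 2 * norm x" by (auto simp: R_def)
    let ?a = "Complex (- R) (- R)" and ?b = "Complex R R"
    let ?J = "\<lambda>a b. contour_integral (linepath a b) (\<lambda>z. f z / (z - x))"
    have large: "norm z \<ge> R" if "z \<in> path_image (rectpath ?a ?b)" for z
      using that R abs_Re_le_cmod[of z] abs_Im_le_cmod[of z] by (auto simp: path_image_rectpath)
    have x_R: "x \<notin> path_image (rectpath ?a ?b)"
      using large[of x] R by auto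
    have R_slit: "path_image (rectpath ?a ?b) \<inter> slit \<subseteq> {0}"
      using path_image_rectpath_Int_slit(1)[of R R R] R by auto
    have x_box: "x \<in> box ?a ?b"
      using abs_Re_le_cmod[of x] abs_Im_le_cmod[of x] R x
      by (auto simp: in_box_complex_iff)
    have bound: "norm (?J a b) \<le> 2 * \<epsilon> / R * (2 * R)"
      if "closed_segment a b \<subseteq> path_image (rectpath ?a ?b)" "norm (b - a) = 2 * R" for a b
    proof -
      have "norm (?J a b) \<le> 2 * \<epsilon> / R * norm (b - a)"
      proof (rule contour_integral_bound_linepath)
        show "(\<lambda>z. f z / (z - x)) contour_integrable_on linepath a b"
          using that(1) x_R R_slit
          by (intro contour_integrable_continuous_linepath continuous_intros cont') auto
        fix z assume "z \<in> closed_segment a b"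
        then have z: "norm z \<ge> R" using large that(1) by blast
        then have "norm (z - x) \<ge> R / 2"
          using norm_triangle_ineq2[of z x] R by linarith
        moreover have "norm (f z) \<le> \<epsilon>" using B z R by simp
        ultimately have "norm (f z) / norm (z - x) \<le> \<epsilon> / (R / 2)"
          using R \<open>\<epsilon> > 0\<close> by (intro frac_le) auto
        then show "norm (f z / (z - x)) \<le> 2 * \<epsilon> / R"
          by (simp add: norm_divide mult.commute)
      qed (use \<open>\<epsilon> > 0\<close> R in auto)
      then show ?thesis using that(2) by simp
    qed
    have sides: "closed_segment ?a (Complex R (- R)) \<subseteq> path_image (rectpath ?a ?b)"
      "closed_segment (Complex R (- R)) ?b \<subseteq> path_image (rectpath ?a ?b)"
      "closed_segment ?b (Complex (- R) R) \<subseteq> path_image (rectpath ?a ?b)"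
      "closed_segment (Complex (- R) R) ?a \<subseteq> path_image (rectpath ?a ?b)"
      by (auto simp: rectpath_def Let_def path_image_join)
    have "contour_integral (C_rect r c) g = contour_integral (rectpath (Complex (- c) (- r)) (Complex 1 r)) g"
      using pos by (intro contour_integral_C_rect_eq_wider g_holo g_cont) auto
    also have "\<dots> = contour_integral (rectpath ?a ?b) g"
      using pos R by (intro contour_integral_rectpath_around_slit g_holo) auto
    also have "\<dots> = contour_integral (rectpath ?a ?b) (\<lambda>z. f z / (z - x)) - 2 * of_real pi * \<i> * f x"
      using x_box by (simp add: g_eq R_slit x_R winding_number_rectpath)
    finally have "I = contour_integral (rectpath ?a ?b) (\<lambda>z. f z / (z - x))"
      by (simp add: I_def)
    also have "\<dots> = ?J ?a (Complex R (- R)) + ?J (Complex R (- R)) ?b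
        + ?J ?b (Complex (- R) R) + ?J (Complex (- R) R) ?a"
      using x_R R_slit
      by (subst contour_integral_rectpath) (auto intro!: continuous_intros cont')
    finally have I_eq: "I = ?J ?a (Complex R (- R)) + ?J (Complex R (- R)) ?b
        + ?J ?b (Complex (- R) R) + ?J (Complex (- R) R) ?a" .
    have "norm I \<le> 2 * \<epsilon> / R * (2 * R) + 2 * \<epsilon> / R * (2 * R)
        + 2 * \<epsilon> / R * (2 * R) + 2 * \<epsilon> / R * (2 * R)"
      unfolding I_eq using R sides
      by (intro norm_triangle_mono bound) (auto simp: cmod_def real_sqrt_mult power2_eq_square)
    then show ?thesis using R by simp
  qed
  from this[of "\<epsilon> / 16" for \<epsilon>] have "norm I \<le> 0 + \<epsilon>" if "\<epsilon> > 0" for \<epsilon>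
    using that by simp
  then have "norm I \<le> 0" by (rule field_le_epsilon)
  then show ?thesis
    by (simp add: I_def C_eq add_eq_0_iff2)
qed

section \<open>Contour integrals of exponentials\<close>

lemma has_field_derivative_exp_linepath:
  fixes h :: "complex \<Rightarrow> complex"
  assumes h: "continuous_on (closed_segment a b) h"
  shows "((\<lambda>s. contour_integral (linepath a b) (\<lambda>z. h z * exp (s * z))) has_field_derivative
           contour_integral (linepath a b) (\<lambda>z. z * h z * exp (s * z))) (at s)"
proof -
  have h': "continuous_on {0..1} (\<lambda>t. h (linepath a b t))"
    by (rule continuous_on_compose2[OF h]) (auto simp: linepath_in_path)
  then have h'': "continuous_on (UNIV \<times> {0..1}) (\<lambda>p::complex \<times> real. h (linepath a b (snd p)))"
    by (rule continuous_on_compose2) (auto intro!: continuous_intros)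
  have "((\<lambda>s. integral (cbox 0 1) (\<lambda>t. h (linepath a b t) * exp (s * linepath a b t) * (b - a)))
      has_field_derivative
      integral (cbox 0 1) (\<lambda>t. linepath a b t * h (linepath a b t) * exp (s * linepath a b t) * (b - a)))
      (at s within UNIV)"
  proof (rule leibniz_rule_field_derivative)
    show "(\<lambda>t. h (linepath a b t) * exp (s * linepath a b t) * (b - a)) integrable_on cbox 0 1" for s
      using h' by (intro integrable_continuous continuous_intros) auto
    show "continuous_on (UNIV \<times> cbox 0 1)
        (\<lambda>(s, t). linepath a b t * h (linepath a b t) * exp (s * linepath a b t) * (b - a))"
      using h'' unfolding case_prod_unfold linepath_def
      by (intro continuous_intros) auto
  qed (auto intro!: derivative_eq_intros)
  then show ?thesis by (simp add: contour_integral_integral)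
qed

lemma has_field_derivative_exp_rectpath:
  fixes h :: "complex \<Rightarrow> complex"
  assumes h: "continuous_on (path_image (rectpath a b)) h"
  shows "((\<lambda>s. contour_integral (rectpath a b) (\<lambda>z. h z * exp (s * z))) has_field_derivative
           contour_integral (rectpath a b) (\<lambda>z. z * h z * exp (s * z))) (at s)"
proof -
  have "continuous_on (path_image (rectpath a b)) (\<lambda>z. h z * exp (s * z))"
    "continuous_on (path_image (rectpath a b)) (\<lambda>z. z * h z * exp (s * z))" for s
    using h by (auto intro!: continuous_intros)
  note sums = contour_integral_rectpath[OF this(1)] contour_integral_rectpath[OF this(2)]
  show ?thesis
    unfolding sums
    by (intro DERIV_add has_field_derivative_exp_linepath continuous_on_subset[OF h])
      (auto simp: rectpath_def Let_def path_image_join)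
qed

text \<open>The assumption on the end points means that the segment lies in the open left half plane except
  possibly for one end point, so for \<open>s \<rightarrow> \<infinity>\<close> the factor \<open>exp (s z)\<close> tends to \<open>0\<close> almost everywhere on
  it while its modulus stays at most \<open>1\<close>.\<close>

lemma exp_linepath_tendsto_0:
  fixes h :: "complex \<Rightarrow> complex"
  assumes h: "continuous_on (closed_segment a b) h"
    and ab: "Re a \<le> 0" "Re b \<le> 0" "Re a + Re b < 0"
  shows "((\<lambda>s::real. contour_integral (linepath a b) (\<lambda>z. h z * exp (complex_of_real s * z))) \<longlongrightarrow> 0) at_top"
proof -
  let ?F = "\<lambda>s t. h (linepath a b t) * exp (complex_of_real s * linepath a b t) * (b - a)"
  have h': "continuous_on {0..1} (\<lambda>t. h (linepath a b t))"
    by (rule continuous_on_compose2[OF h]) (auto simp: linepath_in_path)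
  have F: "continuous_on {0..1} (?F s)" for s
    by (intro continuous_intros h')
  have Re: "Re (linepath a b t) = (1 - t) * Re a + t * Re b" for t
    by (simp add: linepath_def)
  have neg: "Re (linepath a b t) < 0" if "0 < t" "t < 1" for t
  proof (cases "Re a < 0")
    case True
    then show ?thesis
      using that ab by (simp add: Re add_neg_nonpos mult_pos_neg mult_nonneg_nonpos)
  next
    case False
    then show ?thesis
      using that ab by (simp add: Re mult_pos_neg)
  qed
  have nonpos: "Re (linepath a b t) \<le> 0" if "t \<in> {0..1}" for t
    using that ab by (simp add: Re add_nonpos_nonpos mult_nonneg_nonpos)
  have "bounded ((\<lambda>t. h (linepath a b t)) ` {0..1})"
    using h' by (intro compact_imp_bounded compact_continuous_image) auto
  then obtain K where K: "\<And>t. t \<in> {0..1} \<Longrightarrow> norm (h (linepath a b t)) \<le> K"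
    unfolding bounded_iff by blast
  have CI: "contour_integral (linepath a b) (\<lambda>z. h z * exp (complex_of_real s * z))
      = (\<integral>t. indicator {0..1} t *\<^sub>R ?F s t \<partial>lborel)" for s
  proof -
    have "contour_integral (linepath a b) (\<lambda>z. h z * exp (complex_of_real s * z)) = integral {0..1} (?F s)"
      by (simp add: contour_integral_integral)
    also have "\<dots> = (LINT t:{0..1}|lborel. ?F s t)"
      by (rule set_borel_integral_eq_integral(2)[OF borel_integrable_atLeastAtMost'[OF F], symmetric])
    finally show ?thesis unfolding set_lebesgue_integral_def .
  qed
  have "((\<lambda>s. \<integral>t. indicator {0..1} t *\<^sub>R ?F s t \<partial>lborel) \<longlongrightarrow> (\<integral>t. 0 \<partial>(lborel :: real measure))) at_top"
  proof (rule integral_dominated_convergence_at_top)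
    show "(\<lambda>t. indicator {0..1} t *\<^sub>R ?F s t) \<in> borel_measurable lborel" for s
      using borel_integrable_atLeastAtMost'[OF F[of s]] by (auto simp: set_integrable_def)
    show "integrable lborel (\<lambda>t::real. indicator {0..1} t *\<^sub>R (K * norm (b - a)))"
      by (intro integrable_scaleR_left integrable_real_indicator) auto
    show "AE t in lborel. ((\<lambda>s. indicator {0..1} t *\<^sub>R ?F s t) \<longlongrightarrow> 0) at_top"
      using AE_lborel_singleton[of 0] AE_lborel_singleton[of "1::real"]
    proof eventually_elim
      case (elim t)
      show ?case
      proof (cases "t \<in> {0..1}")
        case True
        with elim have "Re (linepath a b t) < 0" by (intro neg) auto
        then have "((\<lambda>s. exp (s * Re (linepath a b t))) \<longlongrightarrow> 0) at_top"
          by real_asymp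
        then have "((\<lambda>s. exp (complex_of_real s * linepath a b t)) \<longlongrightarrow> 0) at_top"
          by (subst tendsto_norm_zero_iff[symmetric]) simp
        then have "((\<lambda>s. ?F s t) \<longlongrightarrow> h (linepath a b t) * 0 * (b - a)) at_top"
          by (intro tendsto_intros)
        with True show ?thesis by simp
      qed simp
    qed
    show "\<forall>\<^sub>F s in at_top. AE t in lborel.
        norm (indicator {0..1} t *\<^sub>R ?F s t) \<le> indicator {0..1} t *\<^sub>R (K * norm (b - a))"
      using eventually_ge_at_top[of 0]
    proof eventually_elim
      case (elim s)
      have "norm (?F s t) \<le> K * norm (b - a)" if "t \<in> {0..1}" for t
      proof -
        have "norm (exp (complex_of_real s * linepath a b t)) \<le> 1"
          using elim nonpos[OF that] by (simp add: mult_nonneg_nonpos)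
        then have "norm (h (linepath a b t)) * norm (exp (complex_of_real s * linepath a b t)) \<le> K * 1"
          using K[OF that] by (intro mult_mono) (auto intro: order_trans[OF norm_ge_zero])
        then show ?thesis by (simp add: norm_mult mult_right_mono)
      qed
      then show ?case by (intro AE_I2) (auto simp: indicator_def)
    qed
  qed simp
  then show ?thesis by (simp add: CI)
qed

lemma contour_integral_bend:
  assumes cont: "continuous_on (convex hull {a, b, c}) h"
    and holo: "h holomorphic_on interior (convex hull {a, b, c})"
  shows "contour_integral (linepath a b) h + contour_integral (linepath b c) h
       = contour_integral (linepath a c) h"
proof -
  have seg: "closed_segment a b \<subseteq> convex hull {a, b, c}"
    "closed_segment b c \<subseteq> convex hull {a, b, c}" "closed_segment c a \<subseteq> convex hull {a, b, c}"
    by (intro closed_segment_subset convex_convex_hull hull_inc; simp)+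
  then have int: "h contour_integrable_on linepath a b" "h contour_integrable_on linepath b c"
    "h contour_integrable_on linepath c a"
    by (auto intro!: contour_integrable_continuous_linepath continuous_on_subset[OF cont])
  have "0 = contour_integral (linepath a b) h + contour_integral (linepath b c) h
      + contour_integral (linepath c a) h"
    using contour_integral_unique[OF Cauchy_theorem_triangle_interior[OF cont holo]] int
    by (simp add: add.assoc)
  also have "contour_integral (linepath c a) h = - contour_integral (linepath a c) h"
    using contour_integral_reversepath[of "linepath a c" h] by simp
  finally show ?thesis by (simp add: algebra_simps)
qed

text \<open>Each half of the vertical side is replaced by two sides of a triangle with third vertex \<open>-r \<plusminus> \<i> r\<close>, so
  that every segment satisfies the hypothesis of \<open>exp_linepath_tendsto_0\<close>. The hypotheses on
  \<open>h\<close> concern the closed left half plane because the lemma has to cover \<open>f z / (z - x)\<close>, whose pole \<open>x\<close>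
  is a positive real number.\<close>

lemma exp_C_rect_tendsto_0:
  assumes holo: "h holomorphic_on {z. Re z < 0} - slit"
    and cont: "continuous_on ({z. Re z \<le> 0} - slit \<union> {0}) h"
    and pos: "c > 1" "r > 0"
  shows "((\<lambda>s::real. contour_integral (C_rect r c) (\<lambda>z. h z * exp (complex_of_real s * z))) \<longlongrightarrow> 0) at_top"
proof -
  let ?I = "\<lambda>a b (s::real). contour_integral (linepath a b) (\<lambda>z. h z * exp (complex_of_real s * z))"
  have cont: "continuous_on A h" if "A \<inter> slit \<subseteq> {0}" "A \<subseteq> {z. Re z \<le> 0}" for A
    using that by (intro continuous_on_subset[OF cont]) auto
  have cont': "continuous_on A (\<lambda>z. h z * exp (complex_of_real s * z))"
    if "A \<inter> slit \<subseteq> {0}" "A \<subseteq> {z. Re z \<le> 0}" for A s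
    by (intro continuous_intros cont that)
  (* U and L are convex sectors, above and below the cut and touching it only at 0, that contain the
     upper and the lower triangle. *)
  define U where "U = {z. Re z \<le> 0 \<and> Im z \<ge> 0 \<and> inner (Complex 1 1) z \<ge> 0}"
  define L where "L = {z. Re z \<le> 0 \<and> Im z \<le> 0 \<and> inner (Complex 1 (- 1)) z \<ge> 0}"
  have "convex U" "convex L"
    unfolding U_def L_def Collect_conj_eq
    by (intro convex_Int convex_halfspace_Re_le convex_halfspace_Im_ge convex_halfspace_Im_le convex_halfspace_ge)+
  have UL_Re: "U \<subseteq> {z. Re z \<le> 0}" "L \<subseteq> {z. Re z \<le> 0}"
    by (auto simp: U_def L_def)
  have U_slit: "U \<inter> slit \<subseteq> {0}" and L_slit: "L \<inter> slit \<subseteq> {0}"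
    by (auto simp: U_def L_def slit_def inner_complex_def complex_eq_iff)
  have bend: "?I a p s + ?I p b s = ?I a b s"
    if A: "A = U \<or> A = L" and sub: "{a, p, b} \<subseteq> A" for A a p b s
  proof (rule contour_integral_bend)
    have hull: "convex hull {a, p, b} \<subseteq> A"
      using sub A \<open>convex U\<close> \<open>convex L\<close> by (intro hull_minimal) auto
    show "continuous_on (convex hull {a, p, b}) (\<lambda>z. h z * exp (complex_of_real s * z))"
      using A U_slit L_slit UL_Re hull by (intro cont') blast+
    have "interior U \<subseteq> interior {z. inner 1 z \<le> 0} \<inter> interior {z. inner \<i> z \<ge> 0}"
      "interior L \<subseteq> interior {z. inner 1 z \<le> 0} \<inter> interior {z. inner \<i> z \<le> 0}"
      unfolding Int_subset_iff by (intro conjI interior_mono; auto simp: U_def L_def inner_complex_def)+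
    then have "interior A \<subseteq> {z. Re z < 0} - slit"
      using A interior_halfspace_le[of "1::complex" 0] interior_halfspace_le[of \<i> 0]
        interior_halfspace_ge[of \<i> 0]
      by (auto simp: slit_def inner_complex_def)
    then show "(\<lambda>z. h z * exp (complex_of_real s * z)) holomorphic_on interior (convex hull {a, p, b})"
      using interior_mono[OF hull]
      by (intro holomorphic_intros holomorphic_on_subset[OF holo]) auto
  qed
  have segs: "closed_segment (Complex (- c) (- r)) (Complex 0 (- r)) \<inter> slit \<subseteq> {0}"
    "closed_segment (Complex 0 (- r)) (Complex 0 r) \<inter> slit \<subseteq> {0}"
    "closed_segment (Complex 0 r) (Complex (- c) r) \<inter> slit \<subseteq> {0}"
    "closed_segment (Complex (- c) r) (Complex (- c) (- r)) \<inter> slit \<subseteq> {0}"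
    using path_image_rectpath_Int_slit(1)[of c r 0] pos
    by (auto simp: rectpath_def Let_def path_image_join)
  have Re_seg: "closed_segment a b \<subseteq> {z. Re z \<le> 0}" if "Re a \<le> 0" "Re b \<le> 0" for a b
    using that by (intro closed_segment_subset) (auto simp: convex_halfspace_Re_le)
  have tri: "{Complex 0 (- r), Complex (- r) (- r), 0} \<subseteq> L" "{0, Complex (- r) r, Complex 0 r} \<subseteq> U"
    using pos by (auto simp: U_def L_def inner_complex_def)
  have seg_tri: "closed_segment a b \<inter> slit \<subseteq> {0}" if "{a, b} \<subseteq> U \<or> {a, b} \<subseteq> L" for a b
    using that U_slit L_slit \<open>convex U\<close> \<open>convex L\<close> closed_segment_subset[of a U b] closed_segment_subset[of a L b]
    by auto
  have split: "?I (Complex 0 (- r)) (Complex 0 r) s = ?I (Complex 0 (- r)) 0 s + ?I 0 (Complex 0 r) s" for s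
    using pos segs(2)
    by (intro contour_integral_split_linepath cont' Re_seg)
      (simp_all add: closed_segment_same_Re closed_segment_eq_real_ivl)
  have "contour_integral (C_rect r c) (\<lambda>z. h z * exp (complex_of_real s * z)) =
      ?I (Complex (- c) (- r)) (Complex 0 (- r)) s
      + ((?I (Complex 0 (- r)) (Complex (- r) (- r)) s + ?I (Complex (- r) (- r)) 0 s)
        + (?I 0 (Complex (- r) r) s + ?I (Complex (- r) r) (Complex 0 r) s))
      + ?I (Complex 0 r) (Complex (- c) r) s + ?I (Complex (- c) r) (Complex (- c) (- r)) s" for s
    unfolding C_rect_def bend[OF disjI2[OF refl] tri(1)] bend[OF disjI1[OF refl] tri(2)] split[symmetric]
    using path_image_rectpath_Int_slit(1)[of c r 0] pos
    by (subst contour_integral_rectpath) (auto intro!: cont' simp: path_image_rectpath)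
  moreover have "((\<lambda>s. ?I (Complex (- c) (- r)) (Complex 0 (- r)) s
      + ((?I (Complex 0 (- r)) (Complex (- r) (- r)) s + ?I (Complex (- r) (- r)) 0 s)
        + (?I 0 (Complex (- r) r) s + ?I (Complex (- r) r) (Complex 0 r) s))
      + ?I (Complex 0 r) (Complex (- c) r) s + ?I (Complex (- c) r) (Complex (- c) (- r)) s)
      \<longlongrightarrow> 0 + ((0 + 0) + (0 + 0)) + 0 + 0) at_top"
    using pos tri
    by (intro tendsto_add exp_linepath_tendsto_0 cont segs seg_tri Re_seg) auto
  ultimately show ?thesis by simp
qed

lemma set_integrable_exp_times_bounded:
  fixes \<phi> :: "real \<Rightarrow> complex"
  assumes "x > 0" and cont: "continuous_on {0..} \<phi>" and bdd: "bounded (\<phi> ` {0..})"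
  shows "set_integrable lborel {0..} (\<lambda>s. exp (- (complex_of_real s * complex_of_real x)) * \<phi> s)"
proof -
  obtain K where K: "\<And>s. s \<ge> 0 \<Longrightarrow> norm (\<phi> s) \<le> K"
    using bdd unfolding bounded_iff by auto
  have "(\<integral>\<^sup>+s. ennreal (exp (- (s * x))) * indicator {0..} s \<partial>lborel) = ennreal (0 - (- exp (- (0 * x)) / x))"
  proof (rule nn_integral_FTC_atLeast)
    show "((\<lambda>s. - exp (- (s * x)) / x) \<longlongrightarrow> 0) at_top"
      using \<open>x > 0\<close> by real_asymp
    show "((\<lambda>s. - exp (- (s * x)) / x) has_real_derivative exp (- (s * x))) (at s)" for s
      using \<open>x > 0\<close> by (auto intro!: derivative_eq_intros)
  qed auto
  moreover have "ennreal (indicator {0..} s *\<^sub>R exp (- (s * x))) = ennreal (exp (- (s * x))) * indicator {0..} s" for s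
    by (simp add: indicator_def)
  ultimately have "set_integrable lborel {0..} (\<lambda>s. exp (- (s * x)))"
    unfolding set_integrable_def by (intro integrableI_nonneg) auto
  then have "set_integrable lborel {0..} (\<lambda>s. exp (- (s * x)) * K)"
    by simp
  then show ?thesis
  proof (rule set_integrable_bound)
    have "continuous_on {0..} (\<lambda>s. exp (- (complex_of_real s * complex_of_real x)) * \<phi> s)"
      by (intro continuous_intros cont)
    then show "set_borel_measurable lborel {0..} (\<lambda>s. exp (- (complex_of_real s * complex_of_real x)) * \<phi> s)"
      by (simp add: set_borel_measurable_def borel_measurable_continuous_on_indicator)
    show "AE s in lborel. s \<in> {0..} \<longrightarrow> norm (exp (- (complex_of_real s * complex_of_real x)) * \<phi> s)
        \<le> norm (exp (- (s * x)) * K)"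
      using K by (intro AE_I2) (auto simp: norm_mult abs_mult intro!: mult_left_mono order_trans[OF K])
  qed
qed

section \<open>The integral representation\<close>

theorem theorem1p1:
  fixes \<alpha> :: complex and r c :: real
  assumes "c > 1" and "r > 0"
  shows "(\<forall>s. (\<lambda>z. f_fun \<alpha> z * exp (s * z)) contour_integrable_on C_rect r c)
    \<and> phi \<alpha> r c holomorphic_on UNIV
    \<and> (\<forall>r' c'. c' > 1 \<and> r' > 0 \<longrightarrow> phi \<alpha> r' c' = phi \<alpha> r c)
    \<and> (\<forall>x::real. x > 0 \<longrightarrow>
         set_integrable lborel {0..}
           (\<lambda>s. exp (- (complex_of_real s * complex_of_real x)) * phi \<alpha> r c (complex_of_real s))
         \<and> f_fun \<alpha> (complex_of_real x) =
             (LINT s:{0..}|lborel.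
                exp (- (complex_of_real s * complex_of_real x)) * phi \<alpha> r c (complex_of_real s)))
    \<and> bounded ((\<lambda>s::real. phi \<alpha> r c (complex_of_real s)) ` {0..})
    \<and> ((\<lambda>s::real. phi \<alpha> r c (complex_of_real s)) \<longlongrightarrow> 0) at_top"
proof -
  let ?D = "\<lambda>h s. contour_integral (C_rect r c) (\<lambda>z. h z * exp (s * z))"
  let ?\<phi> = "\<lambda>s::real. phi \<alpha> r c (complex_of_real s)"
  note f_cont = continuous_on_off_slit[OF f_fun_holomorphic f_fun_isCont_0]
  have C_slit: "path_image (C_rect r c) \<inter> slit \<subseteq> {0}"
    using path_image_rectpath_Int_slit(1)[of c r 0] assms by (simp add: C_rect_def)

  have integrable: "(\<lambda>z. f_fun \<alpha> z * exp (s * z)) contour_integrable_on C_rect r c" for s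
    unfolding C_rect_def using C_slit
    by (intro continuous_on_rectpath_integrable continuous_intros f_cont) (simp add: C_rect_def)

  have D_deriv: "(?D h has_field_derivative ?D (\<lambda>z. z * h z) s) (at s)"
    if "continuous_on (path_image (C_rect r c)) h" for h s
    using has_field_derivative_exp_rectpath[of _ _ h s] that unfolding C_rect_def by simp
  have phi_eq: "phi \<alpha> r c = (\<lambda>s. 1 / (2 * of_real pi * \<i>) * ?D (f_fun \<alpha>) s)"
    by (simp add: phi_def fun_eq_iff)
  have "phi \<alpha> r c field_differentiable at s" for s
    unfolding phi_eq using D_deriv[OF f_cont[OF C_slit], of \<alpha> s]
    by (intro field_differentiable_mult field_differentiable_const)
      (auto simp: field_differentiable_def)
  then have entire: "phi \<alpha> r c holomorphic_on UNIV"
    by (simp add: holomorphic_on_def field_differentiable_at_within)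

  (* Every contour is compared with the reference rectangle [-2,1] x [-1,1]. *)
  have wider: "contour_integral (C_rect r' c') (\<lambda>z. f_fun \<alpha> z * exp (s * z)) =
      contour_integral (rectpath (Complex (- 2) (- 1)) (Complex 1 1)) (\<lambda>z. f_fun \<alpha> z * exp (s * z))"
    if "c' > 1" "r' > 0" for r' c' s
  proof -
    have holo: "(\<lambda>z. f_fun \<alpha> z * exp (s * z)) holomorphic_on - slit"
      by (intro holomorphic_intros f_fun_holomorphic)
    have "isCont (\<lambda>z. f_fun \<alpha> z * exp (s * z)) 0"
      by (intro continuous_intros f_fun_isCont_0)
    then show ?thesis
      using contour_integral_C_rect_eq_wider[OF holo, of c' r' 1]
        contour_integral_rectpath_around_slit[OF holo, of c' r' 1 2 1 1] that
      by simp
  qed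
  have independent: "phi \<alpha> r' c' = phi \<alpha> r c" if "c' > 1" "r' > 0" for r' c'
    using that assms by (simp add: phi_def fun_eq_iff wider)

  have "((\<lambda>s. 1 / (2 * of_real pi * \<i>) * ?D (f_fun \<alpha>) (complex_of_real s)) \<longlongrightarrow> 1 / (2 * of_real pi * \<i>) * 0) at_top"
    using assms
    by (intro tendsto_intros exp_C_rect_tendsto_0 f_cont holomorphic_on_subset[OF f_fun_holomorphic]) auto
  then have tendsto: "(?\<phi> \<longlongrightarrow> 0) at_top"
    by (simp add: phi_eq)
  have cont: "continuous_on A ?\<phi>" for A
    by (rule continuous_on_compose2[OF holomorphic_on_imp_continuous_on[OF entire]])
      (auto intro!: continuous_intros)
  have bdd: "bounded (?\<phi> ` {0..})"
  proof -
    from tendsto have "\<forall>\<^sub>F s in at_top. norm (?\<phi> s) < 1"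
      by (auto simp: tendsto_iff)
    then obtain T where T: "\<And>s. s \<ge> T \<Longrightarrow> norm (?\<phi> s) < 1"
      by (auto simp: eventually_at_top_linorder)
    have "bounded (?\<phi> ` {0..T})"
      by (intro compact_imp_bounded compact_continuous_image cont) auto
    moreover have "bounded (?\<phi> ` {T..})"
      using T by (auto simp: bounded_iff intro!: exI[of _ 1] less_imp_le)
    ultimately have "bounded (?\<phi> ` ({0..T} \<union> {T..}))"
      by (simp add: image_Un)
    then show ?thesis
      by (rule bounded_subset) (intro image_mono, auto)
  qed

  have laplace: "set_integrable lborel {0..} (\<lambda>s. exp (- (complex_of_real s * complex_of_real x)) * ?\<phi> s)
      \<and> f_fun \<alpha> (complex_of_real x) =
          (LINT s:{0..}|lborel. exp (- (complex_of_real s * complex_of_real x)) * ?\<phi> s)"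
    if x: "x > 0" for x
  proof
    let ?e = "\<lambda>s. exp (- (complex_of_real s * complex_of_real x)) * ?\<phi> s"
    show int: "set_integrable lborel {0..} ?e"
      using x cont bdd by (rule set_integrable_exp_times_bounded)
    (* Psi is a primitive of the Laplace integrand that vanishes at infinity. *)
    define h where "h = (\<lambda>z. f_fun \<alpha> z / (z - complex_of_real x))"
    define \<Psi> where "\<Psi> = (\<lambda>s. exp (- (s * complex_of_real x)) * (1 / (2 * of_real pi * \<i>) * ?D h s))"
    have notin: "complex_of_real x \<notin> path_image (C_rect r c)"
      using x assms by (auto simp: C_rect_def path_image_rectpath)
    have h_cont: "continuous_on (path_image (C_rect r c)) h"
      unfolding h_def using notin by (intro continuous_intros f_cont C_slit) auto
    have h_int: "(\<lambda>z. g z * exp (s * z)) contour_integrable_on C_rect r c"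
      if "continuous_on (path_image (C_rect r c)) g" for g s
      unfolding C_rect_def using that
      by (intro continuous_on_rectpath_integrable continuous_intros) (simp add: C_rect_def)
    (* Differentiating under the integral brings down z, and the factor exp (- s x) brings down - x;
       together they cancel the denominator of h. *)
    have key: "?D (\<lambda>z. z * h z) s - complex_of_real x * ?D h s = ?D (f_fun \<alpha>) s" for s
    proof -
      have "?D (\<lambda>z. z * h z) s - complex_of_real x * ?D h s =
          ?D (\<lambda>z. z * h z) s - contour_integral (C_rect r c) (\<lambda>z. complex_of_real x * (h z * exp (s * z)))"
        using h_int[OF h_cont] by (simp add: contour_integral_lmul)
      also have "\<dots> = contour_integral (C_rect r c) (\<lambda>z. z * h z * exp (s * z) - complex_of_real x * (h z * exp (s * z)))"
        by (intro contour_integral_diff[symmetric] h_int contour_integrable_lmul h_cont continuous_intros)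
      also have "\<dots> = ?D (f_fun \<alpha>) s"
      proof (rule contour_integral_eq)
        fix z assume "z \<in> path_image (C_rect r c)"
        then have "z \<noteq> complex_of_real x" using notin by auto
        then have "f_fun \<alpha> z = (z - complex_of_real x) * h z" by (simp add: h_def)
        then show "z * h z * exp (s * z) - complex_of_real x * (h z * exp (s * z)) = f_fun \<alpha> z * exp (s * z)"
          by (simp only: left_diff_distrib mult.assoc)
      qed
      finally show ?thesis .
    qed
    have "(\<Psi> has_field_derivative exp (- (s * complex_of_real x)) * phi \<alpha> r c s) (at s)" for s
    proof -
      have "(\<Psi> has_field_derivative
          exp (- (s * complex_of_real x)) * (1 / (2 * of_real pi * \<i>)) * (?D (\<lambda>z. z * h z) s - complex_of_real x * ?D h s)) (at s)"
        unfolding \<Psi>_def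
        by (rule derivative_eq_intros D_deriv[OF h_cont] refl)+ (simp add: algebra_simps)
      then show ?thesis unfolding key by (simp add: phi_eq mult.assoc)
    qed
    then have "((\<lambda>s. \<Psi> (complex_of_real s)) has_vector_derivative ?e s) (at s within A)" for s A
      by (rule has_vector_derivative_real_field)
    then have FTC: "(?e has_integral \<Psi> (complex_of_real T) - \<Psi> (complex_of_real 0)) {0..T}"
      if "T \<ge> 0" for T
      using that by (intro fundamental_theorem_of_calculus) auto
    have int_T: "set_integrable lborel {0..T} ?e" for T
      by (rule set_integrable_subset[OF int]) auto
    have partial: "(LINT s:{0..T}|lborel. ?e s) = \<Psi> (complex_of_real T) - \<Psi> 0" if "T \<ge> 0" for T
      using set_borel_integral_eq_integral(2)[OF int_T[of T]] integral_unique[OF FTC[OF that]] by simp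
    have "((\<lambda>T. LINT s:{0..T}|lborel. ?e s) \<longlongrightarrow> (LINT s:{0..}|lborel. ?e s)) at_top"
      by (rule tendsto_set_lebesgue_integral_at_top[OF _ int]) auto
    moreover have "((\<lambda>T. LINT s:{0..T}|lborel. ?e s) \<longlongrightarrow> 0 * (1 / (2 * of_real pi * \<i>) * 0) - \<Psi> 0) at_top"
    proof (rule Lim_transform_eventually)
      show "\<forall>\<^sub>F T in at_top. \<Psi> (complex_of_real T) - \<Psi> 0 = (LINT s:{0..T}|lborel. ?e s)"
        using eventually_ge_at_top[of 0] by eventually_elim (simp add: partial)
      have "((\<lambda>T. exp (- (T * x))) \<longlongrightarrow> 0) at_top"
        using x by real_asymp
      then have "((\<lambda>T. exp (- (complex_of_real T * complex_of_real x))) \<longlongrightarrow> 0) at_top"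
        by (subst tendsto_norm_zero_iff[symmetric]) simp
      moreover have "((\<lambda>T. ?D h (complex_of_real T)) \<longlongrightarrow> 0) at_top"
        unfolding h_def using x assms
        by (intro exp_C_rect_tendsto_0 holomorphic_intros continuous_intros f_cont
            holomorphic_on_subset[OF f_fun_holomorphic]) auto
      ultimately show "((\<lambda>T. \<Psi> (complex_of_real T) - \<Psi> 0)
          \<longlongrightarrow> 0 * (1 / (2 * of_real pi * \<i>) * 0) - \<Psi> 0) at_top"
        unfolding \<Psi>_def by (intro tendsto_intros)
    qed
    ultimately have "(LINT s:{0..}|lborel. ?e s) = 0 * (1 / (2 * of_real pi * \<i>) * 0) - \<Psi> 0"
      by (rule tendsto_unique[OF trivial_limit_at_top_linorder])
    also have "\<dots> = f_fun \<alpha> (complex_of_real x)"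
      using Cauchy_exterior_C_rect[OF f_fun_holomorphic f_fun_isCont_0 f_fun_tendsto_0_at_infinity assms,
          of "complex_of_real x" \<alpha>] x
      by (simp add: \<Psi>_def h_def)
    finally show "f_fun \<alpha> (complex_of_real x) = (LINT s:{0..}|lborel. ?e s)" by simp
  qed

  show ?thesis
    using integrable entire independent laplace bdd tendsto by blast
qed

end
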